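(* Let $h\ge 1$, let $m_1,\dots,m_h,n_1,\dots,n_h$ be positive integers, let $G=\mathrm{NSG}(m_1,\ldots,m_h;n_1,\ldots,n_h)$, and let $\lambda\neq 0,-1$ be an eigenvalue of $G$. Then for every $i=1,\ldots,h-1$, at least one of the sets $U_i,U_{i+1}$ consists only of downer vertices for $\lambda$, and at least one of the sets $V_i,V_{i+1}$ consists only of downer vertices for $\lambda$.
   Context: All graphs are simple; eigenvalues of a graph are those of its adjacency matrix. The nested split (threshold) graph $\mathrm{NSG}(m_1,\ldots,m_h;n_1,\ldots,n_h)$ has vertex set the disjoint union of sets $U_1,\dots,U_h,V_1,\dots,V_h$ with $|U_i|=m_i$, $|V_i|=n_i$; the set $V=\bigcup_i V_i$ induces a clique, the set $U=\bigcup_i U_i$ induces a co-clique, and a vertex $u\in U_i$ is adjacent to a vertex $v\in V_j$ if and only if $j\le i$. For an eigenvalue $\lambda$ of a graph $G$ of multiplicity $k\ge1$ and a vertex $v$, $v$ is a downer, neutral, or Parter vertex for $\lambda$ according as the multiplicity of $\lambda$ as an eigenvalue of $G-v$ is $k-1$, $k$, or $k+1$. *)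

theory Defs
  imports
    "Graph_Theory.Pair_Digraph"
    "Jordan_Normal_Form.Char_Poly"
begin

text \<open>
  Finite simple graphs are the symmetric loop-free digraphs of the \<open>Graph_Theory\<close> entry
  (locales \<^locale>\<open>graph\<close> and \<^locale>\<open>pair_graph\<close>), an edge being a pair of opposite arcs.
\<close>

definition adjacency_mat_of :: "('a, 'b) pre_digraph \<Rightarrow> 'a list \<Rightarrow> real mat" where
  "adjacency_mat_of G vs = mat (length vs) (length vs)
     (\<lambda>(i, j). if (vs ! i, vs ! j) \<in> arcs_ends G then 1 else 0)"

text \<open>
  The adjacency matrix with respect to an arbitrary but fixed enumeration of the vertices;
  by the lemmas below, its characteristic polynomial and its eigenvalues do not depend on
  the enumeration.
\<close>

definition adjacency_mat :: "('a, 'b) pre_digraph \<Rightarrow> real mat" where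
  "adjacency_mat G = adjacency_mat_of G (SOME vs. distinct vs \<and> set vs = verts G)"

definition eigenvalue_mult :: "('a, 'b) pre_digraph \<Rightarrow> real \<Rightarrow> nat" where
  "eigenvalue_mult G \<mu> = order \<mu> (char_poly (adjacency_mat G))"

text \<open>The equation forces the multiplicity in \<open>G\<close> to be at least 1.\<close>

definition downer :: "('a, 'b) pre_digraph \<Rightarrow> real \<Rightarrow> 'a \<Rightarrow> bool" where
  "downer G \<mu> v \<longleftrightarrow> v \<in> verts G \<and>
     eigenvalue_mult (pre_digraph.del_vert G v) \<mu> + 1 = eigenvalue_mult G \<mu>"

text \<open>
  The vertices of a nested split graph are \<open>UV i k\<close> and \<open>VV i k\<close>, the \<open>k\<close>-th elements
  (counting from 0) of the cells \<open>U\<^sub>i\<close> and \<open>V\<^sub>i\<close>. The cell sizes are functions,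
  of which only the values at \<open>1, \<dots>, h\<close> matter.
\<close>

datatype nsg_vertex = UV nat nat | VV nat nat

definition U_cell :: "(nat \<Rightarrow> nat) \<Rightarrow> nat \<Rightarrow> nsg_vertex set" where
  "U_cell m i = UV i ` {..<m i}"

definition V_cell :: "(nat \<Rightarrow> nat) \<Rightarrow> nat \<Rightarrow> nsg_vertex set" where
  "V_cell n i = VV i ` {..<n i}"

definition NSG_pair ::
  "nat \<Rightarrow> (nat \<Rightarrow> nat) \<Rightarrow> (nat \<Rightarrow> nat) \<Rightarrow> nsg_vertex pair_pre_digraph" where
  "NSG_pair h m n =
    \<lparr> pverts = (\<Union>i\<in>{1..h}. U_cell m i) \<union> (\<Union>i\<in>{1..h}. V_cell n i),
      parcs =
        {(x, y) | x y. x \<in> (\<Union>i\<in>{1..h}. V_cell n i) \<and> y \<in> (\<Union>i\<in>{1..h}. V_cell n i) \<and> x \<noteq> y} \<union>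
        {(u, v) | u v. \<exists>i\<in>{1..h}. \<exists>j\<in>{1..h}. u \<in> U_cell m i \<and> v \<in> V_cell n j \<and> j \<le> i} \<union>
        {(v, u) | u v. \<exists>i\<in>{1..h}. \<exists>j\<in>{1..h}. u \<in> U_cell m i \<and> v \<in> V_cell n j \<and> j \<le> i} \<rparr>"

definition NSG ::
  "nat \<Rightarrow> (nat \<Rightarrow> nat) \<Rightarrow> (nat \<Rightarrow> nat) \<Rightarrow> (nsg_vertex, nsg_vertex \<times> nsg_vertex) pre_digraph" where
  "NSG h m n = with_proj (NSG_pair h m n)"

lemma pair_graph_NSG_pair: "pair_graph (NSG_pair h m n)"
proof -
  have fin: "finite (pverts (NSG_pair h m n))"
    by (auto simp: NSG_pair_def U_cell_def V_cell_def)
  have sub: "parcs (NSG_pair h m n) \<subseteq> pverts (NSG_pair h m n) \<times> pverts (NSG_pair h m n)"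
    unfolding NSG_pair_def by auto
  have sym: "sym (parcs (NSG_pair h m n))"
    unfolding NSG_pair_def sym_def by auto
  show ?thesis
  proof
    show "finite (parcs (NSG_pair h m n))"
      using fin sub by (meson finite_SigmaI finite_subset)
    show "symmetric (with_proj (NSG_pair h m n))"
      using sym by (simp add: symmetric_def)
    show "fst e \<noteq> snd e" if "e \<in> parcs (NSG_pair h m n)" for e
      using that by (auto simp: NSG_pair_def U_cell_def V_cell_def)
  qed (use fin sub in auto)
qed

lemma graph_NSG: "graph (NSG h m n)"
  unfolding NSG_def using pair_graph.pair_graphD_graph[OF pair_graph_NSG_pair] .

lemma char_poly_adjacency_mat_of_cong:
  assumes "distinct vs" "distinct ws" "set vs = set ws"
  shows "char_poly (adjacency_mat_of G vs) = char_poly (adjacency_mat_of G ws)"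
proof -
  define n where "n = length ws"
  have len: "length vs = n"
    using assms unfolding n_def by (metis distinct_card)
  have "mset vs = mset ws"
    using assms by (simp add: set_eq_iff_mset_eq_distinct)
  then obtain p where p: "p permutes {..<n}" and vs: "permute_list p ws = vs"
    unfolding n_def by (metis mset_eq_permutation)
  have p': "p permutes {0..<n}"
    using p by (simp add: atLeast0LessThan)
  have nth: "vs ! i = ws ! p i" if "i < n" for i
    using that vs p permute_list_nth[of p ws i] by (simp add: n_def)
  have lt: "p i < n" if "i < n" for i
    using that p permutes_in_image[of p "{..<n}" i] by simp
  have inj: "p i = p j \<longleftrightarrow> i = j" for i j
    using permutes_inj[OF p] by (auto dest: injD)
  let ?B = "char_poly_matrix (adjacency_mat_of G ws)"
  let ?R = "mat n n (\<lambda>(i, j). ?B $$ (p i, j))"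
  have B: "?B \<in> carrier_mat n n"
    by (simp add: adjacency_mat_of_def n_def)
  have "transpose_mat (char_poly_matrix (adjacency_mat_of G vs))
      = mat n n (\<lambda>(i, j). transpose_mat ?R $$ (p i, j))"
    by (rule eq_matI)
      (auto simp: char_poly_matrix_def adjacency_mat_of_def len n_def[symmetric] nth lt inj)
  then have "det (transpose_mat (char_poly_matrix (adjacency_mat_of G vs)))
      = signof p * det (transpose_mat ?R)"
    using det_permute_rows[of "transpose_mat ?R" n p] p' by simp
  moreover have "det (transpose_mat ?R) = det ?R"
    by (rule det_transpose[of _ n]) simp
  moreover have "det ?R = signof p * det ?B"
    by (rule det_permute_rows[OF B p'])
  moreover have "det (transpose_mat (char_poly_matrix (adjacency_mat_of G vs)))
      = det (char_poly_matrix (adjacency_mat_of G vs))"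
    by (rule det_transpose[of _ n]) (simp add: adjacency_mat_of_def len)
  ultimately show ?thesis
    by (simp add: char_poly_def sign_def)
qed

lemma char_poly_adjacency_mat:
  assumes "distinct vs" "set vs = verts G"
  shows "char_poly (adjacency_mat G) = char_poly (adjacency_mat_of G vs)"
proof -
  have "distinct (SOME vs. distinct vs \<and> set vs = verts G) \<and>
      set (SOME vs. distinct vs \<and> set vs = verts G) = verts G"
    using assms by (intro someI[of "\<lambda>vs. distinct vs \<and> set vs = verts G"]) simp
  then show ?thesis
    unfolding adjacency_mat_def using assms by (intro char_poly_adjacency_mat_of_cong) auto
qed

lemma eigenvalue_adjacency_mat:
  assumes "distinct vs" "set vs = verts G"
  shows "eigenvalue (adjacency_mat G) \<mu> \<longleftrightarrow> eigenvalue (adjacency_mat_of G vs) \<mu>"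
proof -
  have sq: "adjacency_mat_of G us \<in> carrier_mat (length us) (length us)" for us
    by (simp add: adjacency_mat_of_def)
  show ?thesis
    using eigenvalue_root_char_poly[OF sq] char_poly_adjacency_mat[OF assms]
    unfolding adjacency_mat_def by metis
qed

end

theory Submission
  imports Defs
begin

text \<open>
  An eigenfunction for \<open>\<mu> \<noteq> 0, -1\<close> is constant on each cell, and its values \<open>u\<^sub>i\<close> on \<open>U\<^sub>i\<close> and
  \<open>v\<^sub>i\<close> on \<open>V\<^sub>i\<close> satisfy a two-term recurrence. Started at \<open>v\<^sub>1\<close>, the recurrence determines
  everything, so the eigenspace is a line; run downwards, it shows that an eigenfunction vanishing
  on two consecutive cells \<open>U\<^sub>i, U\<^sub>i\<^sub>+\<^sub>1\<close> or \<open>V\<^sub>i, V\<^sub>i\<^sub>+\<^sub>1\<close> is zero. It remains to see that a vertex where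
  the essentially unique eigenfunction \<open>x\<close> does not vanish is a downer. Cramer's rule applied to
  \<open>(t - A) x = (t - \<mu>) x\<close> exhibits \<open>t - \<mu>\<close> as a factor of the characteristic polynomial whose
  cofactor is nonzero at \<open>\<mu>\<close>, by symmetry of \<open>A\<close>; so \<open>\<mu>\<close> is a simple root. An eigenfunction of
  \<open>G - v\<close>, extended by zero, would by symmetry be an eigenfunction of \<open>G\<close> vanishing at \<open>v\<close>, so
  \<open>\<mu>\<close> is not an eigenvalue of \<open>G - v\<close>.
\<close>

section \<open>Linear algebra: simple roots of the characteristic polynomial of a symmetric
  matrix\<close>

text \<open>Cofactors along column \<open>k\<close> do not see that column, so Laplace expansion
  along it lets the scalar out.\<close>

lemma det_replace_col_smult:
  fixes A :: "'a :: comm_ring_1 mat"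
  assumes A: "A \<in> carrier_mat n n" and b: "b \<in> carrier_vec n" and k: "k < n"
  shows "det (replace_col A (c \<cdot>\<^sub>v b) k) = c * det (replace_col A b k)"
proof -
  have car: "replace_col A d k \<in> carrier_mat n n" for d
    using A by (simp add: replace_col_def)
  have "mat_delete (replace_col A (c \<cdot>\<^sub>v b) k) i k = mat_delete (replace_col A b k) i k" for i
    using A by (intro eq_matI) (auto simp: mat_delete_def replace_col_def)
  then have "cofactor (replace_col A (c \<cdot>\<^sub>v b) k) i k = cofactor (replace_col A b k) i k" for i
    by (simp add: cofactor_def)
  then have "(\<Sum>i<n. replace_col A (c \<cdot>\<^sub>v b) k $$ (i, k) * cofactor (replace_col A (c \<cdot>\<^sub>v b) k) i k) =
      c * (\<Sum>i<n. replace_col A b k $$ (i, k) * cofactor (replace_col A b k) i k)"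
    unfolding sum_distrib_left using A b k
    by (intro sum.cong) (auto simp: replace_col_def mult.assoc)
  then show ?thesis
    by (simp only: laplace_expansion_column[OF car k])
qed

text \<open>Subtracting a multiple of \<open>x\<close> makes any eigenvector vanish at
  \<open>k\<close>, so \<open>zero\<close> says that the eigenspace is the line spanned by
  \<open>x\<close>; symmetry turns this geometric multiplicity into the algebraic one.\<close>

lemma order_char_poly_eq_1:
  fixes A :: "real mat"
  assumes A: "A \<in> carrier_mat n n" and sym: "transpose_mat A = A"
    and x: "x \<in> carrier_vec n" and Ax: "A *\<^sub>v x = \<mu> \<cdot>\<^sub>v x"
    and k: "k < n" and xk: "x $ k \<noteq> 0"
    and zero: "\<And>w. w \<in> carrier_vec n \<Longrightarrow> A *\<^sub>v w = \<mu> \<cdot>\<^sub>v w \<Longrightarrow> w $ k = 0 \<Longrightarrow> w = 0\<^sub>v n"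
  shows "order \<mu> (char_poly A) = 1"
proof -
  define C where "C = char_poly_matrix A"
  \<comment> \<open>Constant polynomials, so that Cramer's rule can be used over the polynomial
    ring.\<close>
  define y where "y = vec n (\<lambda>i. [:x $ i:])"
  have C: "C \<in> carrier_mat n n"
    using A by (simp add: C_def)
  have y: "y \<in> carrier_vec n"
    by (simp add: y_def)
  have Ax_i: "(\<Sum>j = 0..<n. A $$ (i, j) * x $ j) = \<mu> * x $ i" if "i < n" for i
    using arg_cong[OF Ax, of "\<lambda>v. v $ i"] that A x by (simp add: scalar_prod_def)
  have Cij: "C $$ (i, j) = (if i = j then [:0, 1:] else 0) - [:A $$ (i, j):]"
    if "i < n" "j < n" for i j
    using that A by (auto simp: C_def char_poly_matrix_def)
  have "C *\<^sub>v y = [:-\<mu>, 1:] \<cdot>\<^sub>v y"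
  proof (rule eq_vecI)
    fix i assume "i < dim_vec ([:-\<mu>, 1:] \<cdot>\<^sub>v y)"
    then have i: "i < n" by (simp add: y_def)
    have "(C *\<^sub>v y) $ i = (\<Sum>j = 0..<n. C $$ (i, j) * [:x $ j:])"
      using i C by (auto simp: scalar_prod_def y_def)
    also have "\<dots> = (\<Sum>j = 0..<n. (if i = j then [:0, x $ i:] else 0) - [:A $$ (i, j) * x $ j:])"
      using i by (intro sum.cong) (auto simp: Cij algebra_simps)
    also have "\<dots> = [:0, x $ i:] - [:\<mu> * x $ i:]"
      using i by (simp add: sum_subtractf Ax_i sum_to_poly)
    also have "\<dots> = ([:-\<mu>, 1:] \<cdot>\<^sub>v y) $ i"
      using i by (simp add: y_def)
    finally show "(C *\<^sub>v y) $ i = ([:-\<mu>, 1:] \<cdot>\<^sub>v y) $ i" .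
  qed (use C in \<open>auto simp: y_def\<close>)
  \<comment> \<open>The determinant of \<open>C\<close> with column \<open>k\<close> replaced by
    \<open>C *\<^sub>v y\<close> is computed twice: by Cramer's rule, and by pulling out the factor
    \<open>[:-\<mu>, 1:]\<close>.\<close>
  with cramer_lemma_mat[OF C y k] det_replace_col_smult[OF C y k, of "[:-\<mu>, 1:]"]
  have eq: "[:x $ k:] * char_poly A = [:-\<mu>, 1:] * det (replace_col C y k)"
    using k by (simp add: y_def C_def char_poly_def)
  have "poly (det (replace_col C y k)) \<mu> \<noteq> 0"
  proof
    \<comment> \<open>Evaluation at \<mu> commutes with determinants, so a zero there would make the
      real matrix \<open>N\<close> singular.\<close>
    have "comm_ring_hom (\<lambda>p. poly p \<mu>)"
      by unfold_locales auto
    note hom_det = comm_ring_hom.hom_det[OF this]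
    define N where "N = map_mat (\<lambda>p. poly p \<mu>) (replace_col C y k)"
    assume "poly (det (replace_col C y k)) \<mu> = 0"
    then have "det N = 0"
      unfolding N_def by (simp only: hom_det)
    moreover have N: "N \<in> carrier_mat n n"
      using C by (simp add: N_def replace_col_def)
    ultimately obtain w where w: "w \<in> carrier_vec n" "w \<noteq> 0\<^sub>v n" "N *\<^sub>v w = 0\<^sub>v n"
      using det_0_iff_vec_prod_zero by blast
    \<comment> \<open>\<open>N\<close> is \<open>\<mu> - A\<close> with column \<open>k\<close> replaced by \<open>x\<close>, so \<open>N w = (\<mu> - A) z + w\<^sub>k x\<close>\<close>
    define z where "z = vec n (\<lambda>j. if j = k then 0 else w $ j)"
    have z: "z \<in> carrier_vec n" "z $ k = 0"
      using k by (simp_all add: z_def)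
    have Az: "A *\<^sub>v z = \<mu> \<cdot>\<^sub>v z + w $ k \<cdot>\<^sub>v x"
    proof (rule eq_vecI)
      fix i assume "i < dim_vec (\<mu> \<cdot>\<^sub>v z + w $ k \<cdot>\<^sub>v x)"
      then have i: "i < n" using x by simp
      have "0 = (\<Sum>j = 0..<n. N $$ (i, j) * w $ j)"
        using arg_cong[OF w(3), of "\<lambda>v. v $ i"] i N w(1) by (simp add: scalar_prod_def)
      also have "\<dots> = (\<Sum>j = 0..<n. (if j = k then w $ k * x $ i else 0)
          + (if j = i then \<mu> * z $ i else 0) - A $$ (i, j) * z $ j)"
        using i k C by (intro sum.cong) (auto simp: N_def replace_col_def Cij y_def z_def algebra_simps)
      also have "\<dots> = w $ k * x $ i + \<mu> * z $ i - (\<Sum>j = 0..<n. A $$ (i, j) * z $ j)"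
        using i k by (simp add: sum_subtractf sum.distrib)
      finally show "(A *\<^sub>v z) $ i = (\<mu> \<cdot>\<^sub>v z + w $ k \<cdot>\<^sub>v x) $ i"
        using i A x z by (simp add: scalar_prod_def)
    qed (use A x in auto)
    \<comment> \<open>Pairing with \<open>x\<close> cancels the terms in
      \<open>x \<bullet> z\<close> and leaves \<open>w $ k\<close> times the squared norm of
      \<open>x\<close>.\<close>
    have "x \<bullet> (A *\<^sub>v z) = (A *\<^sub>v x) \<bullet> z"
      using transpose_vec_mult_scalar[OF A z(1) x] by (simp add: sym)
    then have "\<mu> * (x \<bullet> z) + w $ k * (x \<bullet> x) = \<mu> * (x \<bullet> z)"
      using x z by (simp add: Az Ax scalar_prod_add_distrib[of _ n])
    moreover have "x \<bullet> x \<noteq> 0"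
    proof -
      have "(\<Sum>i = 0..<n. x $ i * x $ i) > 0"
        using k xk by (intro sum_pos2[of _ k]) (auto simp: zero_less_mult_iff)
      then show ?thesis using x by (simp add: scalar_prod_def)
    qed
    ultimately have wk: "w $ k = 0"
      by simp
    then have "A *\<^sub>v z = \<mu> \<cdot>\<^sub>v z"
      unfolding Az wk using x z by (intro eq_vecI) auto
    then have "z = 0\<^sub>v n"
      using zero z by blast
    moreover have "z = w"
      using w wk by (intro eq_vecI) (auto simp: z_def)
    ultimately show False
      using w by simp
  qed
  then have ord: "order \<mu> (det (replace_col C y k)) = 0" and nz: "det (replace_col C y k) \<noteq> 0"
    by (auto simp: order_0I)
  have "order \<mu> (char_poly A) = order \<mu> ([:x $ k:] * char_poly A)"
    using xk by (simp add: order_smult)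
  also have "\<dots> = order \<mu> [:-\<mu>, 1:]"
    unfolding eq using nz ord by (subst order_mult) (simp_all del: mult_pCons_left)
  also have "\<dots> = 1"
    using order_power_n_n[of \<mu> 1] by simp
  finally show ?thesis .
qed

section \<open>The adjacency matrix as an operator on vertex functions\<close>

definition adj_op :: "('a, 'b) pre_digraph \<Rightarrow> ('a \<Rightarrow> real) \<Rightarrow> 'a \<Rightarrow> real" where
  "adj_op G f a = (\<Sum>b\<in>verts G. if (a, b) \<in> arcs_ends G then f b else 0)"

lemma adj_op_diff:
  "adj_op G (\<lambda>a. c * f a - d * g a) a = c * adj_op G f a - d * adj_op G g a"
  unfolding adj_op_def sum_distrib_left sum_subtractf[symmetric] by (intro sum.cong) auto

text \<open>Swap the two summations and reverse every arc.\<close>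

lemma adj_op_symmetric:
  assumes "symmetric G"
  shows "(\<Sum>a\<in>verts G. f a * adj_op G g a) = (\<Sum>a\<in>verts G. adj_op G f a * g a)"
proof -
  have "(a, b) \<in> arcs_ends G \<longleftrightarrow> (b, a) \<in> arcs_ends G" for a b
    using assms by (auto simp: symmetric_def dest: symD)
  then have "(\<Sum>a\<in>verts G. \<Sum>b\<in>verts G. f a * (if (a, b) \<in> arcs_ends G then g b else 0)) =
      (\<Sum>a\<in>verts G. \<Sum>b\<in>verts G. (if (b, a) \<in> arcs_ends G then f a else 0) * g b)"
    by (intro sum.cong) auto
  also have "\<dots> = (\<Sum>b\<in>verts G. \<Sum>a\<in>verts G. (if (b, a) \<in> arcs_ends G then f a else 0) * g b)"
    by (rule sum.swap)
  finally show ?thesis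
    by (simp add: adj_op_def sum_distrib_left sum_distrib_right)
qed

lemma adjacency_mat_of_mult_vec:
  assumes "distinct vs" "set vs = verts G"
  shows "adjacency_mat_of G vs *\<^sub>v vec (length vs) (\<lambda>i. f (vs ! i)) =
    vec (length vs) (\<lambda>i. adj_op G f (vs ! i))"
proof (rule eq_vecI)
  fix i assume "i < dim_vec (vec (length vs) (\<lambda>i. adj_op G f (vs ! i)))"
  moreover have "bij_betw (\<lambda>j. vs ! j) {0..<length vs} (verts G)"
    using assms by (intro bij_betw_nth) auto
  ultimately show "(adjacency_mat_of G vs *\<^sub>v vec (length vs) (\<lambda>i. f (vs ! i))) $ i =
      vec (length vs) (\<lambda>i. adj_op G f (vs ! i)) $ i"
    by (auto simp: adjacency_mat_of_def scalar_prod_def adj_op_def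
        sum.reindex_bij_betw[symmetric] intro!: sum.cong)
qed (simp add: adjacency_mat_of_def)

lemma adjacency_mat_of_eigen_iff:
  assumes "distinct vs" "set vs = verts G"
  shows "adjacency_mat_of G vs *\<^sub>v vec (length vs) (\<lambda>i. f (vs ! i)) =
      \<mu> \<cdot>\<^sub>v vec (length vs) (\<lambda>i. f (vs ! i)) \<longleftrightarrow> (\<forall>a\<in>verts G. adj_op G f a = \<mu> * f a)"
  unfolding adjacency_mat_of_mult_vec[OF assms]
  unfolding assms(2)[symmetric] by (auto simp: vec_eq_iff set_conv_nth)

text \<open>Distinctness makes the index of a vertex unique, so entries of a vector can be read off
  by vertex.\<close>

lemma vec_as_vertex_function:
  assumes "distinct vs" "w \<in> carrier_vec (length vs)"
  obtains f where "w = vec (length vs) (\<lambda>i. f (vs ! i))"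
proof
  show "w = vec (length vs) (\<lambda>i. w $ inv_into {..<length vs} ((!) vs) (vs ! i))"
    using assms by (intro eq_vecI) (auto simp: inj_on_nth)
qed

lemma eigenvalue_iff_adj_op:
  assumes "finite (verts G)"
  shows "eigenvalue (adjacency_mat G) \<mu> \<longleftrightarrow>
    (\<exists>f. (\<forall>a\<in>verts G. adj_op G f a = \<mu> * f a) \<and> (\<exists>a\<in>verts G. f a \<noteq> 0))"
proof -
  obtain vs where vs: "distinct vs" "set vs = verts G"
    using assms finite_distinct_list by metis
  let ?v = "\<lambda>f. vec (length vs) (\<lambda>i. f (vs ! i))"
  have nz: "?v f \<noteq> 0\<^sub>v (length vs) \<longleftrightarrow> (\<exists>a\<in>verts G. f a \<noteq> 0)" for f :: "'a \<Rightarrow> real"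
    unfolding vs(2)[symmetric] by (auto simp: vec_eq_iff set_conv_nth)
  have "eigenvalue (adjacency_mat G) \<mu> \<longleftrightarrow>
      (\<exists>w\<in>carrier_vec (length vs). w \<noteq> 0\<^sub>v (length vs) \<and> adjacency_mat_of G vs *\<^sub>v w = \<mu> \<cdot>\<^sub>v w)"
    unfolding eigenvalue_adjacency_mat[OF vs] unfolding eigenvalue_def eigenvector_def
    by (auto simp: adjacency_mat_of_def)
  also have "\<dots> \<longleftrightarrow> (\<exists>f. ?v f \<noteq> 0\<^sub>v (length vs) \<and> adjacency_mat_of G vs *\<^sub>v ?v f = \<mu> \<cdot>\<^sub>v ?v f)"
    using vec_as_vertex_function[OF vs(1)] by (metis vec_carrier)
  finally show ?thesis
    unfolding nz adjacency_mat_of_eigen_iff[OF vs] by blast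
qed

text \<open>The only summand lost is the one at \<open>v\<close>, which is zero. The point
  \<open>a = v\<close> is excluded because deletion removes its arcs.\<close>

lemma adj_op_del_vert:
  assumes "finite (verts G)" "f v = 0" "a \<noteq> v"
  shows "adj_op (pre_digraph.del_vert G v) f a = adj_op G f a"
proof -
  have ends: "(a, b) \<in> arcs_ends (pre_digraph.del_vert G v) \<longleftrightarrow> (a, b) \<in> arcs_ends G \<and> b \<noteq> v" for b
    using assms(3) by (auto simp: arcs_ends_conv pre_digraph.del_vert_def)
  show ?thesis
    unfolding adj_op_def ends using assms(1,2)
    by (intro sum.mono_neutral_cong_left) (auto simp: pre_digraph.del_vert_def)
qed

lemma adj_op_cong:
  "(\<And>b. b \<in> verts G \<Longrightarrow> f b = g b) \<Longrightarrow> adj_op G f a = adj_op G g a"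
  unfolding adj_op_def by (rule sum.cong) auto

section \<open>Multiplicities and a criterion for downers\<close>

lemma eigenvalue_mult_eq_1:
  assumes "finite (verts G)" "symmetric G" "v \<in> verts G"
    and "\<forall>a\<in>verts G. adj_op G f a = \<mu> * f a" and "f v \<noteq> 0"
    and zero: "\<And>g a. \<lbrakk>\<forall>b\<in>verts G. adj_op G g b = \<mu> * g b; g v = 0; a \<in> verts G\<rbrakk> \<Longrightarrow> g a = 0"
  shows "eigenvalue_mult G \<mu> = 1"
proof -
  obtain vs where vs: "distinct vs" "set vs = verts G"
    using assms finite_distinct_list by metis
  obtain k where k: "k < length vs" "vs ! k = v"
    using assms(3) vs(2) by (metis in_set_conv_nth)
  have "order \<mu> (char_poly (adjacency_mat_of G vs)) = 1"
  proof (rule order_char_poly_eq_1)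
    show "transpose_mat (adjacency_mat_of G vs) = adjacency_mat_of G vs"
      using assms(2) by (intro eq_matI) (auto simp: adjacency_mat_of_def symmetric_def dest: symD)
    show "adjacency_mat_of G vs *\<^sub>v vec (length vs) (\<lambda>i. f (vs ! i)) =
        \<mu> \<cdot>\<^sub>v vec (length vs) (\<lambda>i. f (vs ! i))"
      using adjacency_mat_of_eigen_iff[OF vs] assms(4) by blast
  next
    fix w assume w: "w \<in> carrier_vec (length vs)" "adjacency_mat_of G vs *\<^sub>v w = \<mu> \<cdot>\<^sub>v w" "w $ k = 0"
    obtain g where g: "w = vec (length vs) (\<lambda>i. g (vs ! i))"
      using vec_as_vertex_function[OF vs(1) w(1)] .
    have "\<forall>b\<in>verts G. adj_op G g b = \<mu> * g b"
      using w(2) adjacency_mat_of_eigen_iff[OF vs] unfolding g by blast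
    moreover have "g v = 0"
      using w(3) k by (simp add: g)
    ultimately have "g a = 0" if "a \<in> verts G" for a
      using zero that by blast
    then show "w = 0\<^sub>v (length vs)"
      unfolding g vs(2)[symmetric] by (intro eq_vecI) auto
  qed (use k assms(5) in \<open>simp_all add: adjacency_mat_of_def\<close>)
  then show ?thesis
    by (simp add: eigenvalue_mult_def char_poly_adjacency_mat[OF vs])
qed

text \<open>A characteristic polynomial is monic, hence nonzero, so order zero means exactly not
  being a root.\<close>

lemma eigenvalue_mult_eq_0_iff:
  assumes "finite (verts G)"
  shows "eigenvalue_mult G \<mu> = 0 \<longleftrightarrow> \<not> eigenvalue (adjacency_mat G) \<mu>"
proof -
  let ?n = "length (SOME vs. distinct vs \<and> set vs = verts G)"
  have car: "adjacency_mat G \<in> carrier_mat ?n ?n"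
    by (simp add: adjacency_mat_def adjacency_mat_of_def)
  have "char_poly (adjacency_mat G) \<noteq> 0"
    using degree_monic_char_poly[OF car] by auto
  then show ?thesis
    using eigenvalue_root_char_poly[OF car, of \<mu>]
    by (auto simp: eigenvalue_mult_def order_root)
qed

text \<open>The hypothesis \<open>zero\<close> serves twice: it makes \<mu> simple in
  \<open>G\<close>, and it kills the zero extension of an eigenfunction of \<open>G - v\<close>. The
  two multiplicities are thus 1 and 0.\<close>

lemma downerI:
  assumes fin: "finite (verts G)" and sym: "symmetric G" and v: "v \<in> verts G"
    and f: "\<forall>a\<in>verts G. adj_op G f a = \<mu> * f a" and fv: "f v \<noteq> 0"
    and zero: "\<And>g a. \<lbrakk>\<forall>b\<in>verts G. adj_op G g b = \<mu> * g b; g v = 0; a \<in> verts G\<rbrakk> \<Longrightarrow> g a = 0"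
  shows "downer G \<mu> v"
proof -
  let ?D = "pre_digraph.del_vert G v"
  have V: "verts ?D = verts G - {v}"
    by (simp add: pre_digraph.del_vert_def)
  have "\<not> eigenvalue (adjacency_mat ?D) \<mu>"
  proof
    assume "eigenvalue (adjacency_mat ?D) \<mu>"
    then obtain g0 where g0: "\<forall>a\<in>verts ?D. adj_op ?D g0 a = \<mu> * g0 a" "\<exists>a\<in>verts ?D. g0 a \<noteq> 0"
      using fin V by (auto simp: eigenvalue_iff_adj_op)
    \<comment> \<open>The extended function satisfies the eigenvalue equation of \<open>G\<close>
      except possibly at \<open>v\<close>.\<close>
    define g where "g = g0(v := 0)"
    have g_v: "g v = 0"
      by (simp add: g_def)
    have g: "adj_op G g a = \<mu> * g a" if "a \<in> verts G - {v}" for a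
    proof -
      have "adj_op G g a = adj_op ?D g a"
        using fin that by (simp add: adj_op_del_vert g_def)
      also have "\<dots> = adj_op ?D g0 a"
        by (rule adj_op_cong) (simp add: g_def V)
      finally show ?thesis using g0(1) that V by (simp add: g_def)
    qed
    \<comment> \<open>Pairing with \<open>f\<close> cancels all terms away from \<open>v\<close> and
      leaves \<open>f v * adj_op G g v = 0\<close>.\<close>
    have "f v * adj_op G g v + (\<Sum>a\<in>verts G - {v}. f a * adj_op G g a) =
        \<mu> * f v * g v + (\<Sum>a\<in>verts G - {v}. \<mu> * f a * g a)"
      using adj_op_symmetric[OF sym, of f g] f fin v
      by (simp add: sum.remove[of "verts G" v])
    also have "(\<Sum>a\<in>verts G - {v}. f a * adj_op G g a) = (\<Sum>a\<in>verts G - {v}. \<mu> * f a * g a)"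
      by (intro sum.cong) (auto simp: g)
    finally have "adj_op G g v = 0"
      using fv g_v by simp
    then have "\<forall>a\<in>verts G. adj_op G g a = \<mu> * g a"
      using g g_v by (metis DiffI mult_zero_right singletonD)
    then have "g a = 0" if "a \<in> verts G" for a
      using zero g_v that by blast
    moreover obtain a where "a \<in> verts G" "a \<noteq> v" "g0 a \<noteq> 0"
      using g0(2) V by auto
    ultimately show False
      by (metis fun_upd_other g_def)
  qed
  then have "eigenvalue_mult ?D \<mu> = 0"
    using fin V by (simp add: eigenvalue_mult_eq_0_iff)
  moreover have "eigenvalue_mult G \<mu> = 1"
    by (rule eigenvalue_mult_eq_1[of G v f \<mu>, OF fin sym v f fv]) (rule zero)
  ultimately show ?thesis
    using v by (simp add: downer_def)
qed

section \<open>Vertices, arcs and adjacency sums of nested split graphs\<close>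

lemma verts_NSG: "verts (NSG h m n) =
    (\<Union>i\<in>{1..h}. UV i ` {..<m i}) \<union> (\<Union>j\<in>{1..h}. VV j ` {..<n j})"
  by (simp add: NSG_def NSG_pair_def U_cell_def V_cell_def)

lemma in_verts_NSG:
  "UV i k \<in> verts (NSG h m n) \<longleftrightarrow> i \<in> {1..h} \<and> k < m i"
  "VV j l \<in> verts (NSG h m n) \<longleftrightarrow> j \<in> {1..h} \<and> l < n j"
  by (auto simp: verts_NSG)

lemma arcs_ends_NSG:
  "(UV i k, UV i' k') \<notin> arcs_ends (NSG h m n)"
  "(UV i k, VV j l) \<in> arcs_ends (NSG h m n) \<longleftrightarrow>
    i \<in> {1..h} \<and> k < m i \<and> j \<in> {1..h} \<and> l < n j \<and> j \<le> i"
  "(VV j l, UV i k) \<in> arcs_ends (NSG h m n) \<longleftrightarrow>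
    i \<in> {1..h} \<and> k < m i \<and> j \<in> {1..h} \<and> l < n j \<and> j \<le> i"
  "(VV j l, VV j' l') \<in> arcs_ends (NSG h m n) \<longleftrightarrow>
    j \<in> {1..h} \<and> l < n j \<and> j' \<in> {1..h} \<and> l' < n j' \<and> (j, l) \<noteq> (j', l')"
proof -
  have "arcs_ends (NSG h m n) = parcs (NSG_pair h m n)"
    by (simp add: NSG_def)
  note E = this NSG_pair_def U_cell_def V_cell_def
  show "(UV i k, UV i' k') \<notin> arcs_ends (NSG h m n)"
    by (simp add: E image_iff)
  show "(UV i k, VV j l) \<in> arcs_ends (NSG h m n) \<longleftrightarrow>
      i \<in> {1..h} \<and> k < m i \<and> j \<in> {1..h} \<and> l < n j \<and> j \<le> i"
    by (simp add: E image_iff)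
  show "(VV j l, UV i k) \<in> arcs_ends (NSG h m n) \<longleftrightarrow>
      i \<in> {1..h} \<and> k < m i \<and> j \<in> {1..h} \<and> l < n j \<and> j \<le> i"
    by (simp add: E image_iff)
  show "(VV j l, VV j' l') \<in> arcs_ends (NSG h m n) \<longleftrightarrow>
      j \<in> {1..h} \<and> l < n j \<and> j' \<in> {1..h} \<and> l' < n j' \<and> (j, l) \<noteq> (j', l')"
    by (simp add: E image_iff)
qed

lemma sum_verts_NSG:
  fixes g :: "nsg_vertex \<Rightarrow> real"
  shows "(\<Sum>a\<in>verts (NSG h m n). g a) =
    (\<Sum>i=1..h. \<Sum>k<m i. g (UV i k)) + (\<Sum>j=1..h. \<Sum>l<n j. g (VV j l))"
proof -
  have "(\<Sum>a\<in>(\<Union>i\<in>{1..h}. UV i ` {..<m i}). g a) = (\<Sum>i=1..h. \<Sum>k<m i. g (UV i k))"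
    by (subst sum.UNION_disjoint) (auto simp: sum.reindex inj_on_def o_def)
  moreover have "(\<Sum>a\<in>(\<Union>j\<in>{1..h}. VV j ` {..<n j}). g a) = (\<Sum>j=1..h. \<Sum>l<n j. g (VV j l))"
    by (subst sum.UNION_disjoint) (auto simp: sum.reindex inj_on_def o_def)
  ultimately show ?thesis
    unfolding verts_NSG by (subst sum.union_disjoint) auto
qed

lemma adj_op_NSG_U:
  assumes "i \<in> {1..h}" "k < m i"
  shows "adj_op (NSG h m n) f (UV i k) = (\<Sum>j=1..i. \<Sum>l<n j. f (VV j l))"
proof -
  have "adj_op (NSG h m n) f (UV i k) =
      (\<Sum>j=1..h. if j \<le> i then \<Sum>l<n j. f (VV j l) else 0)"
    using assms by (simp add: adj_op_def sum_verts_NSG arcs_ends_NSG) (intro sum.cong, auto)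
  also have "\<dots> = (\<Sum>j=1..i. if j \<le> i then \<Sum>l<n j. f (VV j l) else 0)"
    using assms by (intro sum.mono_neutral_right) auto
  finally show ?thesis by simp
qed

text \<open>The subtracted value is that of the vertex itself, which the clique excludes as a
  neighbour. The first double sum binds \<open>j\<close> and \<open>l\<close> anew, so it is the
  total over the clique.\<close>

lemma adj_op_NSG_V:
  assumes "j \<in> {1..h}" "l < n j"
  shows "adj_op (NSG h m n) f (VV j l) =
    (\<Sum>j=1..h. \<Sum>l<n j. f (VV j l)) - f (VV j l) + (\<Sum>i=j..h. \<Sum>k<m i. f (UV i k))"
proof -
  have 1: "(VV j l, VV j' l') \<in> arcs_ends (NSG h m n) \<longleftrightarrow> (j', l') \<noteq> (j, l)"
    if "j' \<in> {1..h}" "l' < n j'" for j' l'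
    using assms that by (auto simp: arcs_ends_NSG)
  have 2: "(VV j l, UV i k) \<in> arcs_ends (NSG h m n) \<longleftrightarrow> j \<le> i"
    if "i \<in> {1..h}" "k < m i" for i k
    using assms that by (auto simp: arcs_ends_NSG)
  have "(\<Sum>i=1..h. \<Sum>k<m i. if (VV j l, UV i k) \<in> arcs_ends (NSG h m n) then f (UV i k) else 0) =
      (\<Sum>i=1..h. if j \<le> i then \<Sum>k<m i. f (UV i k) else 0)"
    using 2 by (intro sum.cong) auto
  also have "\<dots> = (\<Sum>i=j..h. if j \<le> i then \<Sum>k<m i. f (UV i k) else 0)"
    using assms by (intro sum.mono_neutral_right) auto
  finally have U: "(\<Sum>i=1..h. \<Sum>k<m i. if (VV j l, UV i k) \<in> arcs_ends (NSG h m n) then f (UV i k) else 0) =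
      (\<Sum>i=j..h. \<Sum>k<m i. f (UV i k))"
    by simp
  have "(\<Sum>j'=1..h. \<Sum>l'<n j'. if (VV j l, VV j' l') \<in> arcs_ends (NSG h m n) then f (VV j' l') else 0) =
      (\<Sum>j'=1..h. (\<Sum>l'<n j'. f (VV j' l')) - (if j' = j then f (VV j l) else 0))"
  proof (rule sum.cong)
    fix j' assume j': "j' \<in> {1..h}"
    have "(\<Sum>l'<n j'. if (VV j l, VV j' l') \<in> arcs_ends (NSG h m n) then f (VV j' l') else 0) =
        (\<Sum>l'<n j'. f (VV j' l') - (if l' = l then (if j' = j then f (VV j l) else 0) else 0))"
      using 1 j' by (intro sum.cong) auto
    also have "\<dots> = (\<Sum>l'<n j'. f (VV j' l')) - (if j' = j then f (VV j l) else 0)"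
      using assms by (auto simp: sum_subtractf)
    finally show "(\<Sum>l'<n j'. if (VV j l, VV j' l') \<in> arcs_ends (NSG h m n) then f (VV j' l') else 0) =
        (\<Sum>l'<n j'. f (VV j' l')) - (if j' = j then f (VV j l) else 0)" .
  qed simp
  also have "\<dots> = (\<Sum>j=1..h. \<Sum>l<n j. f (VV j l)) - f (VV j l)"
    using assms by (simp add: sum_subtractf)
  finally have V: "(\<Sum>j'=1..h. \<Sum>l'<n j'. if (VV j l, VV j' l') \<in> arcs_ends (NSG h m n) then f (VV j' l') else 0) =
      (\<Sum>j=1..h. \<Sum>l<n j. f (VV j l)) - f (VV j l)" .
  show ?thesis
    unfolding adj_op_def sum_verts_NSG U V by (rule add.commute)
qed

section \<open>Recurrences for eigenfunctions of a nested split graph\<close>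

text \<open>\<open>f\<close> may vanish identically, so the locale also covers linear combinations
  of eigenfunctions.\<close>

locale NSG_eigenfunction =
  fixes h :: nat and m n :: "nat \<Rightarrow> nat" and \<mu> :: real and f :: "nsg_vertex \<Rightarrow> real"
  assumes h: "h \<ge> 1"
    and m_pos: "\<And>i. i \<in> {1..h} \<Longrightarrow> m i > 0"
    and n_pos: "\<And>i. i \<in> {1..h} \<Longrightarrow> n i > 0"
    and \<mu>_nonzero: "\<mu> \<noteq> 0" and \<mu>_not_m1: "\<mu> \<noteq> -1"
    and eigen: "\<And>a. a \<in> verts (NSG h m n) \<Longrightarrow> adj_op (NSG h m n) f a = \<mu> * f a"
begin

text \<open>Vertex 0 exists in every cell, since the sizes are positive; by \<open>f_U\<close> it
  represents its cell.\<close>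

definition u :: "nat \<Rightarrow> real" where "u i = f (UV i 0)"

definition v :: "nat \<Rightarrow> real" where "v j = f (VV j 0)"

lemma eigen_U:
  assumes "i \<in> {1..h}" "k < m i"
  shows "\<mu> * f (UV i k) = (\<Sum>j=1..i. \<Sum>l<n j. f (VV j l))"
  using eigen[of "UV i k"] assms by (simp add: in_verts_NSG adj_op_NSG_U)

text \<open>Moving the vertex's own value to the left gives the factor \<open>\<mu> + 1\<close> and
  a right-hand side common to the whole cell.\<close>

lemma eigen_V:
  assumes "j \<in> {1..h}" "l < n j"
  shows "(\<mu> + 1) * f (VV j l) =
    (\<Sum>j=1..h. \<Sum>l<n j. f (VV j l)) + (\<Sum>i=j..h. \<Sum>k<m i. f (UV i k))"
proof -
  have "VV j l \<in> verts (NSG h m n)"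
    using assms by (simp add: in_verts_NSG)
  then show ?thesis
    using eigen[of "VV j l"] adj_op_NSG_V[of j h l n m f] assms by (simp add: algebra_simps)
qed

text \<open>The right-hand side of \<open>eigen_U\<close> does not depend on \<open>k\<close>, and
  \<mu> can be cancelled.\<close>

lemma f_U: "f (UV i k) = u i" if "i \<in> {1..h}" "k < m i"
proof -
  have "\<mu> * f (UV i k) = \<mu> * f (UV i 0)"
    using that m_pos by (simp add: eigen_U)
  then show ?thesis
    using \<mu>_nonzero by (simp add: u_def)
qed

lemma f_V: "f (VV j l) = v j" if "j \<in> {1..h}" "l < n j"
proof -
  have "(\<mu> + 1) * f (VV j l) = (\<mu> + 1) * f (VV j 0)"
    using that n_pos by (simp only: eigen_V)
  then show ?thesis
    using \<mu>_not_m1 by (simp add: v_def)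
qed

lemma u_1: "\<mu> * u 1 = n 1 * v 1"
  using eigen_U[of 1 0] m_pos[of 1] h by (simp add: u_def f_V)

text \<open>From cell \<open>i\<close> to cell \<open>Suc i\<close> of the co-clique, neighbourhoods
  grow by exactly \<open>V_cell n (Suc i)\<close>; subtract the two eigenvalue equations.\<close>

lemma u_Suc: "\<mu> * (u (Suc i) - u i) = n (Suc i) * v (Suc i)" if "1 \<le> i" "i < h"
  using eigen_U[of "Suc i" 0] eigen_U[of i 0] m_pos[of i] m_pos[of "Suc i"] that
  by (simp add: u_def f_V algebra_simps)

text \<open>Dually, closed neighbourhoods in the clique shrink by \<open>U_cell m i\<close>.\<close>

lemma v_Suc: "(\<mu> + 1) * (v i - v (Suc i)) = m i * u i" if "1 \<le> i" "i < h"
proof -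
  have "(\<Sum>i'=i..h. \<Sum>k<m i'. f (UV i' k)) =
      (\<Sum>k<m i. f (UV i k)) + (\<Sum>i'=Suc i..h. \<Sum>k<m i'. f (UV i' k))"
    using that by (intro sum.atLeast_Suc_atMost) simp
  moreover have "(\<Sum>k<m i. f (UV i k)) = m i * u i"
    using that by (simp add: f_U)
  ultimately show ?thesis
    using eigen_V[of i 0] eigen_V[of "Suc i" 0] n_pos[of i] n_pos[of "Suc i"] that
    by (simp add: v_def right_diff_distrib)
qed

text \<open>Each step upwards obtains \<open>v (Suc i)\<close> from \<open>v_Suc\<close> first, then
  \<open>u (Suc i)\<close> from \<open>u_Suc\<close>.\<close>

lemma u_v_zero:
  assumes "v 1 = 0" "i \<in> {1..h}"
  shows "u i = 0 \<and> v i = 0"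
proof -
  have "1 \<le> i" "i \<le> h" using assms(2) by auto
  then show ?thesis
  proof (induction rule: dec_induct)
    case base
    then show ?case using assms(1) u_1 \<mu>_nonzero by simp
  next
    case (step i)
    then have "(\<mu> + 1) * v (Suc i) = 0"
      using v_Suc[of i] by simp
    then have "v (Suc i) = 0"
      using \<mu>_not_m1 by simp
    moreover have "\<mu> * u (Suc i) = 0"
      using step calculation u_Suc[of i] by simp
    ultimately show ?case using \<mu>_nonzero by simp
  qed
qed

text \<open>Downwards the order is reversed: \<open>u_Suc\<close> yields \<open>u i\<close>, then
  \<open>v_Suc\<close> yields \<open>v i\<close>.\<close>

lemma v_1_zero:
  assumes "i \<in> {1..h}" "u i = 0" "v i = 0"
  shows "v 1 = 0"
proof -
  have "1 \<le> i" using assms(1) by simp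
  then show ?thesis using assms
  proof (induction rule: dec_induct)
    case (step i)
    then have "\<mu> * u i = 0"
      using u_Suc[of i] by simp
    then have "u i = 0"
      using \<mu>_nonzero by simp
    moreover have "(\<mu> + 1) * v i = 0"
      using step calculation v_Suc[of i] by simp
    ultimately show ?case
      using step \<mu>_not_m1 by simp
  qed
qed

text \<open>Thus \<open>v 1\<close> determines an eigenfunction, and the eigenspace is at most a
  line.\<close>

lemma f_zero:
  assumes "v 1 = 0" "a \<in> verts (NSG h m n)"
  shows "f a = 0"
  using assms u_v_zero by (auto simp: verts_NSG f_U f_V)

text \<open>Two zeros make \<open>u_Suc\<close> force \<open>v (Suc i) = 0\<close>, and the descent
  from \<open>Suc i\<close> then reaches \<open>v 1\<close>.\<close>

lemma U_consecutive:
  assumes "v 1 \<noteq> 0" "1 \<le> i" "i < h"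
  shows "u i \<noteq> 0 \<or> u (Suc i) \<noteq> 0"
proof (rule ccontr)
  assume "\<not> ?thesis"
  then have "u i = 0" "u (Suc i) = 0" by auto
  moreover have "v (Suc i) = 0"
    using calculation u_Suc[of i] n_pos[of "Suc i"] assms by simp
  ultimately show False
    using v_1_zero[of "Suc i"] assms by simp
qed

text \<open>Here \<open>v_Suc\<close> forces \<open>u i = 0\<close>, as \<open>m i\<close> is
  positive, so the descent starts at \<open>i\<close>.\<close>

lemma V_consecutive:
  assumes "v 1 \<noteq> 0" "1 \<le> i" "i < h"
  shows "v i \<noteq> 0 \<or> v (Suc i) \<noteq> 0"
proof (rule ccontr)
  assume "\<not> ?thesis"
  then have "v i = 0" "v (Suc i) = 0" by auto
  moreover have "u i = 0"
    using calculation v_Suc[of i] m_pos[of i] assms by simp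
  ultimately show False
    using v_1_zero[of i] assms by simp
qed

end

section \<open>Downers from nonzero values, and the conclusion for consecutive cells\<close>

lemma (in NSG_eigenfunction) downer_if_nonzero:
  assumes x: "x \<in> verts (NSG h m n)" and fx: "f x \<noteq> 0"
  shows "downer (NSG h m n) \<mu> x"
proof (rule downerI)
  show "finite (verts (NSG h m n))"
    by (simp add: verts_NSG)
  interpret G: graph "NSG h m n"
    by (rule graph_NSG)
  show "symmetric (NSG h m n)"
    by (rule G.sym_arcs)
  show "x \<in> verts (NSG h m n)" "f x \<noteq> 0" "\<forall>a\<in>verts (NSG h m n). adj_op (NSG h m n) f a = \<mu> * f a"
    using x fx eigen by auto
next
  fix g a
  assume g: "\<forall>b\<in>verts (NSG h m n). adj_op (NSG h m n) g b = \<mu> * g b"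
    and gx: "g x = 0" and a: "a \<in> verts (NSG h m n)"
  interpret g: NSG_eigenfunction h m n \<mu> g
    using h m_pos n_pos \<mu>_nonzero \<mu>_not_m1 g by unfold_locales auto
  \<comment> \<open>The coefficients make the combination zero on \<open>V\<^sub>1\<close>; it
    therefore vanishes everywhere, in particular at \<open>x\<close>.\<close>
  have "adj_op (NSG h m n) (\<lambda>a. g.v 1 * f a - v 1 * g a) b = \<mu> * (g.v 1 * f b - v 1 * g b)"
    if "b \<in> verts (NSG h m n)" for b
    unfolding adj_op_diff eigen[OF that] g.eigen[OF that] by (simp add: algebra_simps)
  then interpret d: NSG_eigenfunction h m n \<mu> "\<lambda>a. g.v 1 * f a - v 1 * g a"
    using h m_pos n_pos \<mu>_nonzero \<mu>_not_m1 by unfold_locales auto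
  have "d.v 1 = 0"
    unfolding d.v_def by (simp add: g.v_def v_def)
  then have "g.v 1 * f x - v 1 * g x = 0"
    using d.f_zero x by blast
  then have "g.v 1 = 0"
    using fx gx by simp
  then show "g a = 0"
    using g.f_zero a by blast
qed

theorem theorem2p5:
  fixes h :: nat and m n :: "nat \<Rightarrow> nat" and \<mu> :: real
  assumes "h \<ge> 1"
    and "\<And>i. i \<in> {1..h} \<Longrightarrow> m i > 0"
    and "\<And>i. i \<in> {1..h} \<Longrightarrow> n i > 0"
    and "eigenvalue (adjacency_mat (NSG h m n)) \<mu>"
    and "\<mu> \<noteq> 0" and "\<mu> \<noteq> -1"
  shows "\<forall>i\<in>{1..h - 1}.
      ((\<forall>v\<in>U_cell m i. downer (NSG h m n) \<mu> v) \<or>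
       (\<forall>v\<in>U_cell m (i + 1). downer (NSG h m n) \<mu> v)) \<and>
      ((\<forall>v\<in>V_cell n i. downer (NSG h m n) \<mu> v) \<or>
       (\<forall>v\<in>V_cell n (i + 1). downer (NSG h m n) \<mu> v))"
proof
  fix i assume "i \<in> {1..h - 1}"
  then have i: "1 \<le> i" "i < h" by auto
  have "finite (verts (NSG h m n))"
    by (simp add: verts_NSG)
  then obtain f where f: "\<forall>a\<in>verts (NSG h m n). adj_op (NSG h m n) f a = \<mu> * f a"
      "\<exists>a\<in>verts (NSG h m n). f a \<noteq> 0"
    using assms(4) eigenvalue_iff_adj_op by blast
  interpret NSG_eigenfunction h m n \<mu> f
    using assms f(1) by unfold_locales auto
  have v1: "v 1 \<noteq> 0"
    using f(2) f_zero by blast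
  \<comment> \<open>As \<open>f\<close> is constant on cells, one nonzero value makes every vertex
    of the cell a downer.\<close>
  have U: "\<forall>x\<in>U_cell m j. downer (NSG h m n) \<mu> x" if "u j \<noteq> 0" "j \<in> {1..h}" for j
    using that by (auto simp: U_cell_def in_verts_NSG f_U intro!: downer_if_nonzero)
  have V: "\<forall>x\<in>V_cell n j. downer (NSG h m n) \<mu> x" if "v j \<noteq> 0" "j \<in> {1..h}" for j
    using that by (auto simp: V_cell_def in_verts_NSG f_V intro!: downer_if_nonzero)
  show "((\<forall>v\<in>U_cell m i. downer (NSG h m n) \<mu> v) \<or>
       (\<forall>v\<in>U_cell m (i + 1). downer (NSG h m n) \<mu> v)) \<and>
      ((\<forall>v\<in>V_cell n i. downer (NSG h m n) \<mu> v) \<or>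
       (\<forall>v\<in>V_cell n (i + 1). downer (NSG h m n) \<mu> v))"
    using U[of i] U[of "i + 1"] V[of i] V[of "i + 1"] U_consecutive[OF v1 i] V_consecutive[OF v1 i] i
    by auto
qed

end
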